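(* Let $\beta \in (0,1)$ and $\gamma > 0$ be fixed, and set $\varepsilon_n = n^{-\beta}$ and $\sigma_n = n^{-\gamma}$. Consider, as $n \to \infty$, the problem of testing, based on $X_1,\dots,X_n$, the null hypothesis $\mathcal{H}_0$ that $X_1,\dots,X_n$ are iid $\mathcal{N}(0,1)$ versus the alternative $\mathcal{H}_1$ that $X_1,\dots,X_n$ are iid from the mixture $(1-\varepsilon_n)\,\mathcal{N}(0,1) + \varepsilon_n\,\mathcal{N}(0,\sigma_n^2)$. If $$\gamma < 2\beta - 1,$$ then the likelihood ratio test, and hence any other test procedure, is asymptotically powerless.
   Context: $\mathcal{N}(0,s^2)$ denotes the centered Gaussian distribution on $\mathbb{R}$ with variance $s^2$. The asymptotic regime is $n \to \infty$, and only $n$ large enough that $\varepsilon_n < 1/2$ is considered. The test procedures are allowed to depend on $n$, $\varepsilon_n$ and $\sigma_n$. The likelihood ratio test is the test of the simple hypothesis $\mathcal{H}_0$ versus the simple hypothesis $\mathcal{H}_1$ based on the likelihood ratio of the sample $(X_1,\dots,X_n)$; its risk is the smallest possible, namely $1 - \frac12 \mathbb{E}_0|L-1|$, where $L$ is the likelihood ratio and $\mathbb{E}_0$ is expectation under $\mathcal{H}_0$. The risk of a test is the sum of its probabilities of Type I error (rejecting under $\mathcal{H}_0$) and Type II error (not rejecting under $\mathcal{H}_1$). A testing procedure (a sequence of tests indexed by $n$) is asymptotically powerless if the limit inferior of its risk as $n\to\infty$ is at least $1$. *)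

theory Defs
  imports "HOL-Probability.Probability"
begin

definition mixture_density :: "real \<Rightarrow> real \<Rightarrow> real \<Rightarrow> real" where
  "mixture_density \<epsilon> \<sigma> x = (1 - \<epsilon>) * normal_density 0 1 x + \<epsilon> * normal_density 0 \<sigma> x"

text \<open>The second parameter of \<^const>\<open>normal_density\<close> is the standard deviation.\<close>

definition gaussian :: "real \<Rightarrow> real measure" where
  "gaussian s = density lborel (\<lambda>x. ennreal (normal_density 0 s x))"

definition gaussian_mixture :: "real \<Rightarrow> real \<Rightarrow> real measure" where
  "gaussian_mixture \<epsilon> \<sigma> = density lborel (\<lambda>x. ennreal (mixture_density \<epsilon> \<sigma> x))"

lemma emeasure_gaussian_mixture:
  assumes "0 \<le> \<epsilon>" "\<epsilon> \<le> 1" "A \<in> sets borel"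
  shows "emeasure (gaussian_mixture \<epsilon> \<sigma>) A =
    ennreal (1 - \<epsilon>) * emeasure (gaussian 1) A + ennreal \<epsilon> * emeasure (gaussian \<sigma>) A"
proof -
  have A: "A \<in> sets lborel" using assms(3) by simp
  have "emeasure (gaussian_mixture \<epsilon> \<sigma>) A =
      (\<integral>\<^sup>+x. ennreal (1 - \<epsilon>) * (ennreal (normal_density 0 1 x) * indicator A x)
        + ennreal \<epsilon> * (ennreal (normal_density 0 \<sigma> x) * indicator A x) \<partial>lborel)"
    unfolding gaussian_mixture_def mixture_density_def using A assms(1,2)
    by (subst emeasure_density)
      (auto intro!: nn_integral_cong simp: ennreal_plus ennreal_mult distrib_right mult.assoc)
  also have "\<dots> = ennreal (1 - \<epsilon>) * emeasure (gaussian 1) A + ennreal \<epsilon> * emeasure (gaussian \<sigma>) A"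
    unfolding gaussian_def using A
    by (simp add: emeasure_density nn_integral_add nn_integral_cmult)
  finally show ?thesis .
qed

text \<open>The law of \<open>n\<close> iid observations; a sample is a function on \<^term>\<open>{..<n}\<close>.\<close>

definition iid_sample :: "nat \<Rightarrow> real measure \<Rightarrow> (nat \<Rightarrow> real) measure" where
  "iid_sample n P = (\<Pi>\<^sub>M i\<in>{..<n}. P)"

text \<open>
  Tests are represented by critical functions: \<open>\<phi> x\<close> is the probability of rejecting the null
  hypothesis given the sample \<open>x\<close>. Non-randomized tests are the indicators of measurable
  rejection regions.
\<close>

definition is_test :: "nat \<Rightarrow> ((nat \<Rightarrow> real) \<Rightarrow> real) \<Rightarrow> bool" where
  "is_test n \<phi> \<longleftrightarrow> \<phi> \<in> borel_measurable (iid_sample n borel) \<and>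
     (\<forall>x \<in> space (iid_sample n borel). 0 \<le> \<phi> x \<and> \<phi> x \<le> 1)"

definition type_I_error :: "'a measure \<Rightarrow> ('a \<Rightarrow> real) \<Rightarrow> real" where
  "type_I_error P0 \<phi> = (\<integral>x. \<phi> x \<partial>P0)"

definition type_II_error :: "'a measure \<Rightarrow> ('a \<Rightarrow> real) \<Rightarrow> real" where
  "type_II_error P1 \<phi> = (\<integral>x. 1 - \<phi> x \<partial>P1)"

definition risk :: "'a measure \<Rightarrow> 'a measure \<Rightarrow> ('a \<Rightarrow> real) \<Rightarrow> real" where
  "risk P0 P1 \<phi> = type_I_error P0 \<phi> + type_II_error P1 \<phi>"

definition asymptotically_powerless ::
  "(nat \<Rightarrow> 'a measure) \<Rightarrow> (nat \<Rightarrow> 'a measure) \<Rightarrow> (nat \<Rightarrow> 'a \<Rightarrow> real) \<Rightarrow> bool" where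
  "asymptotically_powerless P0 P1 \<phi> \<longleftrightarrow>
     liminf (\<lambda>n. ereal (risk (P0 n) (P1 n) (\<phi> n))) \<ge> 1"

definition likelihood_ratio :: "nat \<Rightarrow> real \<Rightarrow> real \<Rightarrow> (nat \<Rightarrow> real) \<Rightarrow> real" where
  "likelihood_ratio n \<epsilon> \<sigma> x = (\<Prod>i<n. mixture_density \<epsilon> \<sigma> (x i) / normal_density 0 1 (x i))"

text \<open>
  The threshold 1 is the one that minimizes the sum of the two error probabilities; how ties are
  resolved does not affect this sum.
\<close>

definition likelihood_ratio_test :: "nat \<Rightarrow> real \<Rightarrow> real \<Rightarrow> (nat \<Rightarrow> real) \<Rightarrow> real" where
  "likelihood_ratio_test n \<epsilon> \<sigma> x = (if likelihood_ratio n \<epsilon> \<sigma> x > 1 then 1 else 0)"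

lemma is_test_likelihood_ratio_test: "is_test n (likelihood_ratio_test n \<epsilon> \<sigma>)"
proof -
  have "likelihood_ratio n \<epsilon> \<sigma> \<in> borel_measurable (iid_sample n borel)"
    unfolding likelihood_ratio_def[abs_def] mixture_density_def iid_sample_def by measurable
  then show ?thesis
    unfolding is_test_def likelihood_ratio_test_def[abs_def] by auto
qed

end

theory Submission imports Defs begin

text \<open>
  The proof is the second moment method. Under the null hypothesis the likelihood ratio \<open>L\<close> has
  mean 1, and the risk of any test \<open>\<phi>\<close> equals \<open>1 - E\<^sub>0 ((L - 1) \<phi>)\<close>, because integrating against
  the alternative amounts to integrating \<open>L\<close> against the null. As \<open>0 \<le> \<phi> \<le> 1\<close>, the risk falls
  below 1 by at most \<open>E\<^sub>0 \<bar>L - 1\<bar> \<le> sqrt (E\<^sub>0 L\<^sup>2 - 1)\<close> (\<open>risk_ge_second_moment\<close>). So every test is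
  asymptotically powerless as soon as \<open>E\<^sub>0 L\<^sup>2\<close> tends to 1.

  By independence \<open>E\<^sub>0 L\<^sup>2\<close> is the \<open>n\<close>-th power of the second moment of the likelihood ratio of one
  observation. That moment is the Gaussian integral
  \<open>1 + \<epsilon>\<^sup>2 (1 / (\<sigma> sqrt (2 - \<sigma>\<^sup>2)) - 1)\<close> (\<open>mixture_ratio_moments\<close>), which is at most
  \<open>1 + \<epsilon>\<^sup>2 / \<sigma>\<close> when \<open>\<sigma> < 1\<close>. Hence \<open>E\<^sub>0 L\<^sup>2 \<le> exp (n \<epsilon>\<^sup>2 / \<sigma>)\<close>, and with \<open>\<epsilon> = n powr (- \<beta>)\<close> and
  \<open>\<sigma> = n powr (- \<gamma>)\<close> the exponent is \<open>n powr (1 - 2 * \<beta> + \<gamma>)\<close>. It tends to 0 because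
  \<open>\<gamma> < 2 * \<beta> - 1\<close>.
\<close>

text \<open>
  It is enough to compare the two measures on boxes, where both sides factor into one-dimensional
  integrals. In the application this identifies the likelihood ratio of a sample as the density
  of the alternative with respect to the null.
\<close>

lemma PiM_density:
  fixes M :: "'i \<Rightarrow> 'a measure" and f :: "'i \<Rightarrow> 'a \<Rightarrow> ennreal"
  assumes "product_sigma_finite M" "product_sigma_finite (\<lambda>i. density (M i) (f i))"
    and I: "finite I" and f[measurable]: "\<And>i. f i \<in> borel_measurable (M i)"
  shows "Pi\<^sub>M I (\<lambda>i. density (M i) (f i)) = density (Pi\<^sub>M I M) (\<lambda>x. \<Prod>i\<in>I. f i (x i))"
proof -
  interpret M: product_sigma_finite M by fact
  interpret D: product_sigma_finite "\<lambda>i. density (M i) (f i)" by fact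
  have "density (Pi\<^sub>M I M) (\<lambda>x. \<Prod>i\<in>I. f i (x i)) = Pi\<^sub>M I (\<lambda>i. density (M i) (f i))"
  proof (rule D.PiM_eqI[OF I])
    show "sets (density (Pi\<^sub>M I M) (\<lambda>x. \<Prod>i\<in>I. f i (x i))) = sets (Pi\<^sub>M I (\<lambda>i. density (M i) (f i)))"
      by (simp cong: sets_PiM_cong)
  next
    fix A assume "\<And>i. i \<in> I \<Longrightarrow> A i \<in> sets (density (M i) (f i))"
    then have A[measurable]: "\<And>i. i \<in> I \<Longrightarrow> A i \<in> sets (M i)" by simp
    have box: "Pi\<^sub>E I A \<in> sets (Pi\<^sub>M I M)"
      using I A by (rule sets_PiM_I_finite)
    have "emeasure (density (Pi\<^sub>M I M) (\<lambda>x. \<Prod>i\<in>I. f i (x i))) (Pi\<^sub>E I A)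
        = (\<integral>\<^sup>+x. (\<Prod>i\<in>I. f i (x i)) * indicator (Pi\<^sub>E I A) x \<partial>Pi\<^sub>M I M)"
      using box by (subst emeasure_density) auto
    also have "\<dots> = (\<integral>\<^sup>+x. (\<Prod>i\<in>I. f i (x i) * indicator (A i) (x i)) \<partial>Pi\<^sub>M I M)"
    proof (rule nn_integral_cong)
      fix x assume "x \<in> space (Pi\<^sub>M I M)"
      then have "indicator (Pi\<^sub>E I A) x = (\<Prod>i\<in>I. indicator (A i) (x i) :: ennreal)"
        using I by (auto simp: space_PiM PiE_iff indicator_def prod_zero_iff)
      then show "(\<Prod>i\<in>I. f i (x i)) * indicator (Pi\<^sub>E I A) x = (\<Prod>i\<in>I. f i (x i) * indicator (A i) (x i))"
        by (simp add: prod.distrib)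
    qed
    also have "\<dots> = (\<Prod>i\<in>I. \<integral>\<^sup>+x. f i x * indicator (A i) x \<partial>M i)"
      using I by (intro M.product_nn_integral_prod) auto
    also have "\<dots> = (\<Prod>i\<in>I. emeasure (density (M i) (f i)) (A i))"
      by (intro prod.cong refl) (simp add: emeasure_density)
    finally show "emeasure (density (Pi\<^sub>M I M) (\<lambda>x. \<Prod>i\<in>I. f i (x i))) (Pi\<^sub>E I A)
        = (\<Prod>i\<in>I. emeasure (density (M i) (f i)) (A i))" .
  qed
  then show ?thesis by simp
qed

text \<open>
  Bounding \<open>E ((L - 1) \<phi>)\<close> by \<open>E \<bar>L - 1\<bar>\<close> instead of its maximum \<open>E \<bar>L - 1\<bar> / 2\<close> loses a factor 2,
  which is harmless for a quantity that tends to 0. The passage to the second moment is the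
  Cauchy-Schwarz inequality, obtained here from the variance being nonnegative.
\<close>

lemma (in prob_space) risk_ge_second_moment:
  fixes L \<phi> :: "'a \<Rightarrow> real"
  assumes L[measurable]: "L \<in> borel_measurable M" and L_nonneg: "\<And>x. 0 \<le> L x"
    and sq: "integrable M (\<lambda>x. (L x)\<^sup>2)" and mean: "expectation L = 1"
    and \<phi>[measurable]: "\<phi> \<in> borel_measurable M"
    and \<phi>_bounds: "\<And>x. x \<in> space M \<Longrightarrow> 0 \<le> \<phi> x \<and> \<phi> x \<le> 1"
  shows "1 - sqrt (expectation (\<lambda>x. (L x)\<^sup>2) - 1) \<le> risk M (density M (\<lambda>x. ennreal (L x))) \<phi>"
proof -
  have int_L: "integrable M L" using square_integrable_imp_integrable[OF L sq] .
  have int_\<phi>: "integrable M \<phi>"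
    using \<phi>_bounds by (intro integrable_const_bound[where B=1]) auto
  have int_L\<phi>: "integrable M (\<lambda>x. L x * \<phi> x)"
    using \<phi>_bounds L_nonneg
    by (intro Bochner_Integration.integrable_bound[OF int_L])
      (auto simp: abs_mult mult_left_le)
  have "risk M (density M (\<lambda>x. ennreal (L x))) \<phi> = expectation \<phi> + expectation (\<lambda>x. L x - L x * \<phi> x)"
    unfolding risk_def type_I_error_def type_II_error_def
    using L_nonneg by (subst integral_real_density) (auto simp: right_diff_distrib)
  also have "\<dots> = 1 - expectation (\<lambda>x. L x * \<phi> x - \<phi> x)"
    using int_L int_\<phi> int_L\<phi> mean by simp
  finally have risk_eq: "risk M (density M (\<lambda>x. ennreal (L x))) \<phi>
      = 1 - expectation (\<lambda>x. L x * \<phi> x - \<phi> x)" .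
  have int_sq: "integrable M (\<lambda>x. (L x - 1)\<^sup>2)"
    using sq int_L by (simp add: power2_diff)
  have "expectation (\<lambda>x. L x * \<phi> x - \<phi> x) \<le> expectation (\<lambda>x. \<bar>L x - 1\<bar>)"
  proof (rule integral_mono)
    fix x assume "x \<in> space M"
    then have "0 \<le> \<phi> x" "\<phi> x \<le> 1" using \<phi>_bounds by auto
    then have "(L x - 1) * \<phi> x \<le> \<bar>L x - 1\<bar> * 1"
      by (intro mult_mono) auto
    then show "L x * \<phi> x - \<phi> x \<le> \<bar>L x - 1\<bar>"
      by (simp add: left_diff_distrib)
  qed (use int_L int_\<phi> int_L\<phi> in auto)
  also have "\<dots> \<le> sqrt (expectation (\<lambda>x. (L x - 1)\<^sup>2))"
  proof (rule real_le_rsqrt)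
    have "variance (\<lambda>x. \<bar>L x - 1\<bar>)
        = expectation (\<lambda>x. \<bar>L x - 1\<bar>\<^sup>2) - (expectation (\<lambda>x. \<bar>L x - 1\<bar>))\<^sup>2"
      using int_L int_sq by (intro variance_eq) auto
    then show "(expectation (\<lambda>x. \<bar>L x - 1\<bar>))\<^sup>2 \<le> expectation (\<lambda>x. (L x - 1)\<^sup>2)"
      using variance_positive[of "\<lambda>x. \<bar>L x - 1\<bar>"] by simp
  qed
  also have "expectation (\<lambda>x. (L x - 1)\<^sup>2) = expectation (\<lambda>x. (L x)\<^sup>2) - 1"
    using sq int_L mean by (simp add: power2_diff prob_space)
  finally show ?thesis using risk_eq by simp
qed

text \<open>
  Squaring doubles the precision \<open>1 / s\<^sup>2\<close> and dividing by the standard normal density removes 1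
  from it. The result is again a Gaussian shape, of precision \<open>2 / s\<^sup>2 - 1 = (2 - s\<^sup>2) / s\<^sup>2\<close>, so
  its integral can be read off from the normalizing constants.
\<close>

lemma normal_density_square_over_standard:
  assumes "0 < s" "s < 1"
  shows "(normal_density 0 s x)\<^sup>2 / normal_density 0 1 x
    = 1 / (s * sqrt (2 - s\<^sup>2)) * normal_density 0 (s / sqrt (2 - s\<^sup>2)) x"
proof -
  have s2: "s\<^sup>2 < 1" using assms by (simp add: power_less_one_iff abs_square_less_1)
  define r where "r = sqrt (2 - s\<^sup>2)"
  have r: "r > 0" "r\<^sup>2 = 2 - s\<^sup>2" using s2 by (auto simp: r_def)
  have exponent: "2 * (- (x\<^sup>2 / (2 * s\<^sup>2))) - (- (x\<^sup>2 / 2)) = - (x\<^sup>2 / (2 * (s / r)\<^sup>2))"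
    using assms by (simp add: power_divide r(2) field_simps)
  have e: "(exp (- (x\<^sup>2 / (2 * s\<^sup>2))))\<^sup>2 / exp (- (x\<^sup>2 / 2)) = exp (- (x\<^sup>2 / (2 * (s / r)\<^sup>2)))"
    unfolding exponent[symmetric] by (simp only: exp_diff exp_double)
  define p where "p = sqrt (2 * pi)"
  have p: "p > 0" by (simp add: p_def)
  have sq: "sqrt (2 * pi * t\<^sup>2) = p * t" if "t > 0" for t :: real
    using that by (simp add: p_def real_sqrt_mult)
  have "(normal_density 0 s x)\<^sup>2 / normal_density 0 1 x
      = (1 / (p * s))\<^sup>2 / (1 / p) * ((exp (- (x\<^sup>2 / (2 * s\<^sup>2))))\<^sup>2 / exp (- (x\<^sup>2 / 2)))"
    using sq[OF assms(1)] by (simp add: normal_density_def power_mult_distrib power_divide p_def)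
  also have "(1 / (p * s))\<^sup>2 / (1 / p) = 1 / (s * r) * (1 / (p * (s / r)))"
    using p r(1) assms by (simp add: power2_eq_square field_simps)
  also have "1 / (s * r) * (1 / (p * (s / r))) * ((exp (- (x\<^sup>2 / (2 * s\<^sup>2))))\<^sup>2 / exp (- (x\<^sup>2 / 2)))
      = 1 / (s * r) * normal_density 0 (s / r) x"
    unfolding e using sq[of "s / r"] r(1) assms by (simp add: normal_density_def)
  finally show ?thesis by (simp add: r_def)
qed

lemma gaussian_mixture_eq_density:
  assumes "0 \<le> \<epsilon>" "\<epsilon> \<le> 1"
  shows "gaussian_mixture \<epsilon> s
    = density (gaussian 1) (\<lambda>x. ennreal (mixture_density \<epsilon> s x / normal_density 0 1 x))"
  unfolding gaussian_def gaussian_mixture_def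
  using assms normal_density_pos[of 1 0]
  by (subst density_density_eq)
    (auto simp: mixture_density_def ennreal_mult[symmetric] less_imp_neq[symmetric])

lemma prob_space_gaussian: "0 < s \<Longrightarrow> prob_space (gaussian s)"
  unfolding gaussian_def by (rule prob_space_normal_density)

lemma prob_space_gaussian_mixture:
  assumes "0 \<le> \<epsilon>" "\<epsilon> \<le> 1" "0 < s"
  shows "prob_space (gaussian_mixture \<epsilon> s)"
proof (rule prob_spaceI)
  have "emeasure (gaussian t) UNIV = 1" if "0 < t" for t
    using prob_space.emeasure_space_1[OF prob_space_gaussian[OF that]]
    by (simp add: gaussian_def)
  then have "emeasure (gaussian_mixture \<epsilon> s) UNIV = ennreal (1 - \<epsilon>) + ennreal \<epsilon>"
    using assms by (simp add: emeasure_gaussian_mixture)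
  then show "emeasure (gaussian_mixture \<epsilon> s) (space (gaussian_mixture \<epsilon> s)) = 1"
    using assms by (simp add: gaussian_mixture_def flip: ennreal_plus)
qed

text \<open>
  With \<open>f\<^sub>0\<close> and \<open>f\<^sub>s\<close> the two normal densities, \<open>f\<^sub>0 h\<^sup>2\<close> expands into
  \<open>(1 - \<epsilon>)\<^sup>2 f\<^sub>0 + 2 \<epsilon> (1 - \<epsilon>) f\<^sub>s + \<epsilon>\<^sup>2 f\<^sub>s\<^sup>2 / f\<^sub>0\<close>, whose three terms are multiples of normal
  densities. The coefficient of \<open>\<epsilon>\<^sup>2\<close> in the second moment is the chi-square divergence of
  \<open>gaussian s\<close> from \<open>gaussian 1\<close>.
\<close>

lemma mixture_ratio_moments:
  fixes \<epsilon> s :: real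
  assumes s: "0 < s" "s < 1"
  defines "h \<equiv> \<lambda>x. mixture_density \<epsilon> s x / normal_density 0 1 x"
  shows "has_bochner_integral (gaussian 1) h 1"
    and "has_bochner_integral (gaussian 1) (\<lambda>x. (h x)\<^sup>2) (1 + \<epsilon>\<^sup>2 * (1 / (s * sqrt (2 - s\<^sup>2)) - 1))"
proof -
  have s2: "s\<^sup>2 < 1" using s by (simp add: abs_square_less_1)
  have pos: "0 < normal_density 0 1 x" for x :: real
    by (rule normal_density_pos) simp
  have [measurable]: "h \<in> borel_measurable borel"
    unfolding h_def mixture_density_def by measurable
  have N: "has_bochner_integral lborel (normal_density 0 t) 1" if "0 < t" for t
    using that by (simp add: has_bochner_integral_iff)
  have h1: "normal_density 0 1 x * h x = (1 - \<epsilon>) * normal_density 0 1 x + \<epsilon> * normal_density 0 s x" for x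
    using pos[of x] by (simp add: h_def mixture_density_def)
  have h2: "normal_density 0 1 x * (h x)\<^sup>2 = (1 - \<epsilon>)\<^sup>2 * normal_density 0 1 x
      + (2 * \<epsilon> * (1 - \<epsilon>)) * normal_density 0 s x
      + (\<epsilon>\<^sup>2 * (1 / (s * sqrt (2 - s\<^sup>2)))) * normal_density 0 (s / sqrt (2 - s\<^sup>2)) x" for x
  proof -
    have "normal_density 0 1 x * (h x)\<^sup>2 = (1 - \<epsilon>)\<^sup>2 * normal_density 0 1 x
      + 2 * \<epsilon> * (1 - \<epsilon>) * normal_density 0 s x
      + \<epsilon>\<^sup>2 * ((normal_density 0 s x)\<^sup>2 / normal_density 0 1 x)"
      using pos[of x] by (simp add: h_def mixture_density_def field_simps power2_eq_square)
    then show ?thesis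
      unfolding normal_density_square_over_standard[OF s] by (simp add: mult.assoc)
  qed
  have "has_bochner_integral lborel (\<lambda>x. normal_density 0 1 x * h x) ((1 - \<epsilon>) * 1 + \<epsilon> * 1)"
    unfolding h1 by (intro has_bochner_integral_add has_bochner_integral_mult_right N s) simp_all
  then show "has_bochner_integral (gaussian 1) h 1"
    unfolding gaussian_def by (intro has_bochner_integral_density) auto
  have "has_bochner_integral lborel (\<lambda>x. normal_density 0 1 x * (h x)\<^sup>2)
     ((1 - \<epsilon>)\<^sup>2 * 1 + (2 * \<epsilon> * (1 - \<epsilon>)) * 1 + (\<epsilon>\<^sup>2 * (1 / (s * sqrt (2 - s\<^sup>2)))) * 1)"
    unfolding h2 using s s2
    by (intro has_bochner_integral_add has_bochner_integral_mult_right N) simp_all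
  also have "(1 - \<epsilon>)\<^sup>2 * 1 + (2 * \<epsilon> * (1 - \<epsilon>)) * 1 + (\<epsilon>\<^sup>2 * (1 / (s * sqrt (2 - s\<^sup>2)))) * 1
      = 1 + \<epsilon>\<^sup>2 * (1 / (s * sqrt (2 - s\<^sup>2)) - 1)"
    by (simp add: power2_eq_square algebra_simps)
  finally show "has_bochner_integral (gaussian 1) (\<lambda>x. (h x)\<^sup>2) (1 + \<epsilon>\<^sup>2 * (1 / (s * sqrt (2 - s\<^sup>2)) - 1))"
    unfolding gaussian_def by (intro has_bochner_integral_density) auto
qed

text \<open>
  The non-asymptotic form of the result: while \<open>n \<epsilon>\<^sup>2 / s\<close> is small, no test
  does much better than a blind guess, whose risk is 1.
\<close>

lemma risk_mixture_ge:
  assumes \<epsilon>: "0 \<le> \<epsilon>" "\<epsilon> \<le> 1" and s: "0 < s" "s < 1" and test: "is_test n \<phi>"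
  shows "1 - sqrt (exp (real n * \<epsilon>\<^sup>2 / s) - 1)
    \<le> risk (iid_sample n (gaussian 1)) (iid_sample n (gaussian_mixture \<epsilon> s)) \<phi>"
proof -
  define h where "h = (\<lambda>x. mixture_density \<epsilon> s x / normal_density 0 1 x)"
  define q where "q = 1 + \<epsilon>\<^sup>2 * (1 / (s * sqrt (2 - s\<^sup>2)) - 1)"
  have s2: "s\<^sup>2 < 1" using s by (simp add: abs_square_less_1)
  have h_nonneg: "0 \<le> h x" for x
    using \<epsilon> by (simp add: h_def mixture_density_def)
  have h_int: "integrable (gaussian 1) h" "(\<integral>x. h x \<partial>gaussian 1) = 1"
    and h2_int: "integrable (gaussian 1) (\<lambda>x. (h x)\<^sup>2)" "(\<integral>x. (h x)\<^sup>2 \<partial>gaussian 1) = q"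
    using mixture_ratio_moments[OF s, of \<epsilon>] by (simp_all add: has_bochner_integral_iff h_def q_def)
  have h_meas: "h \<in> borel_measurable (gaussian 1)" using h_int(1) by simp
  interpret G: product_prob_space "\<lambda>_::nat. gaussian 1" "{..<n}"
    by (auto intro!: product_prob_spaceI prob_space_gaussian)
  have H1: "iid_sample n (gaussian_mixture \<epsilon> s)
      = density (iid_sample n (gaussian 1)) (\<lambda>x. ennreal (\<Prod>i<n. h (x i)))"
  proof -
    have mix: "gaussian_mixture \<epsilon> s = density (gaussian 1) (\<lambda>x. ennreal (h x))"
      unfolding h_def by (rule gaussian_mixture_eq_density[OF \<epsilon>])
    interpret D: product_prob_space "\<lambda>_::nat. gaussian_mixture \<epsilon> s" "{..<n}"
      by (intro product_prob_spaceI prob_space_gaussian_mixture \<epsilon> s)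
    show ?thesis
      unfolding iid_sample_def mix
      using D.product_sigma_finite_axioms h_meas
      by (subst PiM_density) (auto simp: mix prod_ennreal h_nonneg G.product_sigma_finite_axioms)
  qed
  have "1 - sqrt ((\<integral>x. (\<Prod>i<n. h (x i))\<^sup>2 \<partial>iid_sample n (gaussian 1)) - 1)
      \<le> risk (iid_sample n (gaussian 1)) (iid_sample n (gaussian_mixture \<epsilon> s)) \<phi>"
    unfolding H1
  proof (rule prob_space.risk_ge_second_moment)
    show "prob_space (iid_sample n (gaussian 1))"
      unfolding iid_sample_def by (intro prob_space_PiM prob_space_gaussian) simp
    show "(\<lambda>x. \<Prod>i<n. h (x i)) \<in> borel_measurable (iid_sample n (gaussian 1))"
      using h_meas unfolding iid_sample_def by measurable
    show "integrable (iid_sample n (gaussian 1)) (\<lambda>x. (\<Prod>i<n. h (x i))\<^sup>2)"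
      unfolding iid_sample_def prod_power_distrib
      by (intro G.product_integrable_prod h2_int) simp
    show "(\<integral>x. (\<Prod>i<n. h (x i)) \<partial>iid_sample n (gaussian 1)) = 1"
      unfolding iid_sample_def
      by (subst G.product_integral_prod) (simp_all add: h_int)
    have "sets (iid_sample n (gaussian 1)) = sets (iid_sample n borel)"
      unfolding iid_sample_def by (intro sets_PiM_cong) (auto simp: gaussian_def)
    then show "\<phi> \<in> borel_measurable (iid_sample n (gaussian 1))"
      "\<And>x. x \<in> space (iid_sample n (gaussian 1)) \<Longrightarrow> 0 \<le> \<phi> x \<and> \<phi> x \<le> 1"
      using test by (auto simp: is_test_def cong: measurable_cong_sets dest: sets_eq_imp_space_eq)
  qed (simp add: h_nonneg prod_nonneg)
  also have "(\<integral>x. (\<Prod>i<n. h (x i))\<^sup>2 \<partial>iid_sample n (gaussian 1)) = q ^ n"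
    unfolding iid_sample_def prod_power_distrib
    by (subst G.product_integral_prod) (simp_all add: h2_int)
  finally have risk: "1 - sqrt (q ^ n - 1)
      \<le> risk (iid_sample n (gaussian 1)) (iid_sample n (gaussian_mixture \<epsilon> s)) \<phi>" .
  have "1 / (s * sqrt (2 - s\<^sup>2)) \<le> 1 / s"
    using s s2 by (intro divide_left_mono) (auto simp: mult_le_cancel_left1)
  then have "1 / (s * sqrt (2 - s\<^sup>2)) - 1 \<le> 1 / s" by simp
  then have "q \<le> 1 + \<epsilon>\<^sup>2 / s"
    unfolding q_def using mult_left_mono[of _ "1 / s" "\<epsilon>\<^sup>2"] by fastforce
  also have "\<dots> \<le> exp (\<epsilon>\<^sup>2 / s)" by (rule exp_ge_add_one_self)
  finally have "q ^ n \<le> exp (\<epsilon>\<^sup>2 / s) ^ n"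
    using h2_int(2) by (intro power_mono) (auto intro: integral_nonneg)
  also have "\<dots> = exp (real n * \<epsilon>\<^sup>2 / s)"
    by (simp flip: exp_of_nat_mult)
  finally have "sqrt (q ^ n - 1) \<le> sqrt (exp (real n * \<epsilon>\<^sup>2 / s) - 1)" by simp
  then show ?thesis using risk by linarith
qed

theorem theorem1:
  fixes \<beta> \<gamma> :: real and \<epsilon> \<sigma> :: "nat \<Rightarrow> real" and H0 H1 :: "nat \<Rightarrow> (nat \<Rightarrow> real) measure"
  assumes "0 < \<beta>" and "\<beta> < 1" and "0 < \<gamma>"
    and "\<And>n. \<epsilon> n = real n powr (- \<beta>)"
    and "\<And>n. \<sigma> n = real n powr (- \<gamma>)"
    and "\<And>n. H0 n = iid_sample n (gaussian 1)"
    and "\<And>n. H1 n = iid_sample n (gaussian_mixture (\<epsilon> n) (\<sigma> n))"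
    and "\<gamma> < 2 * \<beta> - 1"
  shows "asymptotically_powerless H0 H1 (\<lambda>n. likelihood_ratio_test n (\<epsilon> n) (\<sigma> n)) \<and>
    (\<forall>\<phi> :: nat \<Rightarrow> (nat \<Rightarrow> real) \<Rightarrow> real. (\<forall>\<^sub>F n in sequentially. is_test n (\<phi> n)) \<longrightarrow>
         asymptotically_powerless H0 H1 \<phi>)"
proof -
  define b where "b = (\<lambda>n. 1 - sqrt (exp (real n * (\<epsilon> n)\<^sup>2 / \<sigma> n) - 1))"
  have "real n * (\<epsilon> n)\<^sup>2 / \<sigma> n = real n powr (1 - 2 * \<beta> + \<gamma>)" for n
  proof -
    have "real n * (\<epsilon> n)\<^sup>2 / \<sigma> n
        = real n powr 1 * (real n powr (- \<beta>) * real n powr (- \<beta>)) / real n powr (- \<gamma>)"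
      by (simp add: assms(4,5) power2_eq_square)
    also have "\<dots> = real n powr (1 - 2 * \<beta> + \<gamma>)"
      by (simp only: powr_add[symmetric] powr_diff[symmetric]) (simp add: algebra_simps)
    finally show ?thesis .
  qed
  moreover have "(\<lambda>n. real n powr (1 - 2 * \<beta> + \<gamma>)) \<longlonglongrightarrow> 0"
    using assms(8) by (intro tendsto_neg_powr filterlim_real_sequentially) simp
  ultimately have rate: "(\<lambda>n. real n * (\<epsilon> n)\<^sup>2 / \<sigma> n) \<longlonglongrightarrow> 0"
    by simp
  have "b \<longlonglongrightarrow> 1 - sqrt (exp 0 - 1)"
    unfolding b_def by (intro tendsto_intros rate)
  then have "(\<lambda>n. ereal (b n)) \<longlonglongrightarrow> 1"
    by (simp add: one_ereal_def)
  then have lim_b: "liminf (\<lambda>n. ereal (b n)) = 1"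
    by (intro lim_imp_Liminf) simp_all
  have powerless: "asymptotically_powerless H0 H1 \<phi>"
    if tests: "\<forall>\<^sub>F n in sequentially. is_test n (\<phi> n)" for \<phi>
  proof -
    have "\<forall>\<^sub>F n in sequentially. ereal (b n) \<le> ereal (risk (H0 n) (H1 n) (\<phi> n))"
      using tests eventually_gt_at_top[of 1]
    proof eventually_elim
      case (elim n)
      \<comment> \<open>For \<open>n > 1\<close> both powers of \<open>n\<close> lie strictly between 0 and 1.\<close>
      have "0 \<le> \<epsilon> n" "\<epsilon> n \<le> 1" "0 < \<sigma> n" "\<sigma> n < 1"
        using elim(2) assms(1,3) powr_less_mono[of "- \<beta>" 0 "real n"] powr_less_mono[of "- \<gamma>" 0 "real n"]
        by (auto simp: assms(4,5))
      then show ?case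
        using risk_mixture_ge[of "\<epsilon> n" "\<sigma> n" n "\<phi> n"] elim(1) by (simp add: b_def assms(6,7))
    qed
    then show ?thesis
      unfolding asymptotically_powerless_def lim_b[symmetric] by (rule Liminf_mono)
  qed
  then show ?thesis
    by (auto intro!: powerless always_eventually is_test_likelihood_ratio_test)
qed

end
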